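(* Let $\Omega$ be a Lebesgue measurable subset of $\mathbb{R}^N\setminus\{0\}$ with finite Lebesgue measure and assume $\overline D:=\overline{\dim}_B(\infty,\Omega)<-N$. Furthermore, assume that $\|\cdot\|$ is a norm on $\mathbb{R}^N$ such that for some $\alpha\in(-\infty,1)$ the Euclidean norm $|\cdot|$ and $\|\cdot\|$ are equivalent of order $\alpha$ for $(\infty,\Omega)$. Then the difference $$\zeta_{\infty,\Omega}(\,\cdot\,)-\zeta_{\infty,\Omega}(\,\cdot\,;\|\cdot\|)$$ is holomorphic on (at least) the half-plane $\{\operatorname{Re}s>\overline D-(1-\alpha)\}$.
   Context: $|\cdot|$ denotes the Euclidean norm of a vector in $\mathbb{R}^N$ and the $N$-dimensional Lebesgue measure of a set. For $t>0$, ${}_t\Omega:=B_t(0)^c\cap\Omega$, where $B_t(0)$ is the open Euclidean ball of radius $t$ centered at $0$. For $r\in\mathbb{R}$, $\overline{\mathcal M}^r(\infty,\Omega):=\limsup_{t\to+\infty}|{}_t\Omega|/t^{N+r}$, and $\overline{\dim}_B(\infty,\Omega):=\inf\{r\in\mathbb{R}:\overline{\mathcal M}^r(\infty,\Omega)=0\}$. Two norms $\|\cdot\|_1,\|\cdot\|_2$ on $\mathbb{R}^N$ are equivalent of order $\alpha\in\mathbb{R}$ for $(\infty,\Omega)$ if $\|x\|_1=\|x\|_2+O(\|x\|_1^\alpha)$ as $\|x\|_1\to+\infty$, $x\in\Omega$. For a fixed $T>0$, the distance zeta function at infinity is $\zeta_{\infty,\Omega}(s):=\int_{{}_T\Omega}|x|^{-s-N}\,dx$,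 and $\zeta_{\infty,\Omega}(s;\|\cdot\|):=\int_{\{x\in\Omega:\|x\|\ge T\}}\|x\|^{-s-N}\,dx$ is its analogue with the Euclidean norm replaced by $\|\cdot\|$; both integrals converge absolutely for $\operatorname{Re}s>\overline D$. Changing $T$, or integrating the second integrand over ${}_T\Omega$ instead, only adds an entire function. The statement that the difference is holomorphic on a larger half-plane means that it extends holomorphically from $\{\operatorname{Re}s>\overline D\}$ to that half-plane. *)

theory Defs
  imports "HOL-Complex_Analysis.Complex_Analysis" "HOL-Library.Landau_Symbols"
begin

text \<open>The dimension \<open>N\<close> is \<open>CARD('n)\<close>; the Euclidean norm is the library's \<^const>\<open>norm\<close>
  on \<^typ>\<open>real ^ 'n\<close>.\<close>

definition is_norm :: "(real ^ 'n \<Rightarrow> real) \<Rightarrow> bool" where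
  "is_norm \<nu> \<longleftrightarrow>
     (\<forall>x. 0 \<le> \<nu> x) \<and> (\<forall>x. \<nu> x = 0 \<longleftrightarrow> x = 0) \<and>
     (\<forall>c x. \<nu> (c *\<^sub>R x) = \<bar>c\<bar> * \<nu> x) \<and> (\<forall>x y. \<nu> (x + y) \<le> \<nu> x + \<nu> y)"

definition tail :: "real \<Rightarrow> (real ^ 'n) set \<Rightarrow> (real ^ 'n) set" where
  "tail t \<Omega> = - ball 0 t \<inter> \<Omega>"

definition upper_minkowski_content_infty :: "real \<Rightarrow> (real ^ 'n) set \<Rightarrow> ennreal" where
  "upper_minkowski_content_infty r \<Omega> =
     Limsup at_top (\<lambda>t::real. emeasure lebesgue (tail t \<Omega>) / ennreal (t powr (real CARD('n) + r)))"

text \<open>The infimum is taken in \<^typ>\<open>ereal\<close>: the value is \<open>-\<infinity>\<close> if the content vanishes for all real \<open>r\<close>,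
  and \<open>\<infinity>\<close> if it vanishes for none.\<close>

definition upper_box_dim_infty :: "(real ^ 'n) set \<Rightarrow> ereal" where
  "upper_box_dim_infty \<Omega> = Inf (ereal ` {r. upper_minkowski_content_infty r \<Omega> = 0})"

text \<open>The filter describes \<open>\<nu>\<^sub>1 x \<longlongrightarrow> \<infinity>\<close> with \<open>x\<close> restricted to \<open>\<Omega>\<close>.\<close>

definition norms_equiv_order ::
    "real \<Rightarrow> (real ^ 'n) set \<Rightarrow> (real ^ 'n \<Rightarrow> real) \<Rightarrow> (real ^ 'n \<Rightarrow> real) \<Rightarrow> bool" where
  "norms_equiv_order \<alpha> \<Omega> \<nu>\<^sub>1 \<nu>\<^sub>2 \<longleftrightarrow>
     (\<lambda>x. \<nu>\<^sub>1 x - \<nu>\<^sub>2 x) \<in> O[inf (filtercomap \<nu>\<^sub>1 at_top) (principal \<Omega>)](\<lambda>x. \<nu>\<^sub>1 x powr \<alpha>)"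

text \<open>The integrals below are Bochner integrals, hence meaningful only where they converge absolutely,
  i.e. for \<open>Re s\<close> greater than the upper box dimension at infinity.\<close>

definition zeta_infty :: "real \<Rightarrow> (real ^ 'n) set \<Rightarrow> complex \<Rightarrow> complex" where
  "zeta_infty T \<Omega> s =
     (LINT x:tail T \<Omega>|lebesgue. complex_of_real (norm x) powr (- s - of_nat CARD('n)))"

definition zeta_infty_norm ::
    "real \<Rightarrow> (real ^ 'n) set \<Rightarrow> (real ^ 'n \<Rightarrow> real) \<Rightarrow> complex \<Rightarrow> complex" where
  "zeta_infty_norm T \<Omega> \<nu> s =
     (LINT x:{x \<in> \<Omega>. T \<le> \<nu> x}|lebesgue. complex_of_real (\<nu> x) powr (- s - of_nat CARD('n)))"

definition right_half_plane :: "ereal \<Rightarrow> complex set" where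
  "right_half_plane a = {s. a < ereal (Re s)}"

text \<open>A function given on the half-plane \<open>Re s > a\<close> is holomorphic on the larger half-plane \<open>Re s > b\<close>
  in the sense that it has a holomorphic extension to it.\<close>

definition extends_holomorphically :: "(complex \<Rightarrow> complex) \<Rightarrow> ereal \<Rightarrow> ereal \<Rightarrow> bool" where
  "extends_holomorphically f a b \<longleftrightarrow>
     (\<exists>g. g holomorphic_on right_half_plane b \<and> (\<forall>s \<in> right_half_plane a. g s = f s))"

end

theory Submission
  imports Defs
begin

text \<open>
  Put \<open>z = - s - N\<close>. For \<open>Re s > D\<close>, where \<open>D\<close> is the upper box dimension at infinity, the
  difference of the two zeta functions is a single integral over \<open>\<Omega>\<close> whose integrand is the
  difference of \<open>\<bar>x\<bar> powr z\<close> and \<open>\<nu> x powr z\<close>, each cut off below \<open>T\<close> in its own norm. The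
  extension is this same integral: cancellation between the two powers makes it converge on a
  larger half-plane than either term.

  Far out, the mean value inequality applied to \<open>t \<mapsto> t powr z\<close> between \<open>\<bar>x\<bar>\<close> and \<open>\<nu> x\<close>, which
  are comparable because all norms on a finite-dimensional space are equivalent, bounds the
  integrand by a constant times \<open>\<bar>x\<bar> powr (Re z - 1) * \<bar>x\<bar> powr \<alpha>\<close>; so the power has dropped by
  \<open>1 - \<alpha>\<close>. On the remaining bounded part both norms lie in a compact subset of
  \<open>(0, \<infinity>)\<close> wherever their term is nonzero, hence the integrand is bounded there, and \<open>\<Omega>\<close> has
  finite measure. This is \<open>zeta_integrand_diff_bound\<close>; its constants are uniform for \<open>z\<close> in
  bounded sets.

  The definition of \<open>D\<close> bounds the measure of the tails of \<open>\<Omega>\<close>, and a dyadic decomposition turns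
  this into integrability of \<open>max 1 \<bar>x\<bar> powr (- r - N)\<close> over \<open>\<Omega>\<close> for every real \<open>r > D\<close>
  (\<open>integrable_norm_powr_over_upper_box_dim\<close>). With \<open>r = Re s + (1 - \<alpha>)\<close>, diminished a little to
  leave room for a neighbourhood of \<open>s\<close>, the integrand is dominated near every \<open>s\<close> with
  \<open>Re s > D - (1 - \<alpha>)\<close>. It is entire in \<open>s\<close> for fixed \<open>x\<close>, and locally dominated integrals of
  holomorphic functions are holomorphic (\<open>holomorphic_on_dominated_integral\<close>).
\<close>

section \<open>Integrals depending holomorphically on a parameter\<close>

text \<open>Cauchy's inequality on discs of radius \<open>r/2\<close> about the points of the smaller disc bounds the
  derivative there by \<open>2 * B / r\<close>.\<close>

lemma holomorphic_Lipschitz_at_centre: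
  fixes f :: "complex \<Rightarrow> complex"
  assumes hol: "f holomorphic_on S" and S: "open S" "cball z r \<subseteq> S" and r: "0 < r"
    and B: "\<And>w. w \<in> cball z r \<Longrightarrow> norm (f w) \<le> B"
    and s: "s \<in> cball z (r/2)"
  shows "norm (f s - f z) \<le> 2 * B / r * norm (s - z)"
proof (rule field_differentiable_bound[where S = "cball z (r/2)" and f' = "deriv f"])
  fix w assume w: "w \<in> cball z (r/2)"
  have sub: "cball w (r/2) \<subseteq> cball z r"
  proof
    fix v assume "v \<in> cball w (r/2)"
    with w have "dist z v \<le> r/2 + r/2"
      using dist_triangle[of z v w] by (simp add: dist_commute)
    then show "v \<in> cball z r" by simp
  qed
  have "w \<in> S" using w S r sub by force
  then show "(f has_field_derivative deriv f w) (at w within cball z (r/2))"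
    using holomorphic_derivI[OF hol S(1)] by (blast intro: has_field_derivative_at_within)
  have hol': "f holomorphic_on cball w (r/2)"
    using hol S sub by (blast intro: holomorphic_on_subset)
  have "norm ((deriv ^^ 1) f w) \<le> fact 1 * B / (r/2) ^ 1"
  proof (rule Cauchy_inequality)
    show "f holomorphic_on ball w (r/2)" using hol' ball_subset_cball by (blast intro: holomorphic_on_subset)
    show "continuous_on (cball w (r/2)) f" by (rule holomorphic_on_imp_continuous_on[OF hol'])
    fix v assume "norm (w - v) = r/2"
    then have "v \<in> cball w (r/2)" by (simp add: dist_norm)
    then show "norm (f v) \<le> B" using sub B by blast
  qed (use r in auto)
  then show "norm (deriv f w) \<le> 2 * B / r" by (simp add: mult.commute)
qed (use s r in auto)

text \<open>By the Lipschitz bound above, a local dominating function \<open>w\<close> for the integrand also dominates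
  its difference quotients, by \<open>2 * w x / r\<close>. Dominated convergence then differentiates under the
  integral sign.\<close>

lemma holomorphic_on_dominated_integral:
  fixes H :: "'a \<Rightarrow> complex \<Rightarrow> complex"
  assumes S: "open S"
    and meas: "\<And>s. s \<in> S \<Longrightarrow> (\<lambda>x. H x s) \<in> borel_measurable M"
    and hol: "\<And>x. x \<in> space M \<Longrightarrow> H x holomorphic_on S"
    and dom: "\<And>z. z \<in> S \<Longrightarrow> \<exists>r>0. \<exists>w. cball z r \<subseteq> S \<and> integrable M w \<and>
                (\<forall>x\<in>space M. \<forall>s\<in>cball z r. norm (H x s) \<le> w x)"
  shows "(\<lambda>s. LINT x|M. H x s) holomorphic_on S"
proof -
  have "\<exists>D. ((\<lambda>s. LINT x|M. H x s) has_field_derivative D) (at z)" if z: "z \<in> S" for z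
  proof -
    from dom[OF z] obtain r w where r: "r > 0" "cball z r \<subseteq> S" and w: "integrable M w"
      and bd: "\<And>x s. x \<in> space M \<Longrightarrow> s \<in> cball z r \<Longrightarrow> norm (H x s) \<le> w x" by blast
    have int: "integrable M (\<lambda>x. H x s)" if "s \<in> cball z r" for s
    proof (rule Bochner_Integration.integrable_bound[OF w])
      show "(\<lambda>x. H x s) \<in> borel_measurable M" using that r meas by blast
      show "AE x in M. norm (H x s) \<le> norm (w x)"
        using bd[OF _ that] by (intro AE_I2) (smt (verit) real_norm_def)
    qed
    define \<delta> where "\<delta> x = deriv (H x) z" for x
    have quot: "(\<lambda>i. (H x (X i) - H x z) / (X i - z)) \<longlonglongrightarrow> \<delta> x"
      if "x \<in> space M" "\<And>i. X i \<noteq> z" "X \<longlonglongrightarrow> z" for x X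
      using holomorphic_derivI[OF hol[OF that(1)] S z] that(2,3)
      unfolding has_field_derivative_iff \<delta>_def tendsto_at_iff_sequentially comp_def by auto
    \<comment> \<open>The limit is taken inside the smaller disc, where the Lipschitz bound applies.\<close>
    have "((\<lambda>s. ((LINT x|M. H x s) - (LINT x|M. H x z)) / (s - z)) \<longlongrightarrow> (LINT x|M. \<delta> x)) (at z within cball z (r/2))"
      unfolding tendsto_at_iff_sequentially comp_def
    proof (intro allI impI)
      fix X assume X: "\<forall>i. X i \<in> cball z (r/2) - {z}" "X \<longlonglongrightarrow> z"
      have Xc: "X i \<in> cball z r" "X i \<in> cball z (r/2)" "X i \<noteq> z" for i
      proof -
        show "X i \<in> cball z (r/2)" "X i \<noteq> z" using X(1) by blast+
        then show "X i \<in> cball z r" using r(1) by simp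
      qed
      have zc: "z \<in> cball z r" using r by simp
      have XS: "X i \<in> S" for i using Xc(1)[of i] r by blast
      have m: "(\<lambda>x. (H x (X i) - H x z) / (X i - z)) \<in> borel_measurable M" for i
        using meas[OF XS, of i] meas[OF z] by measurable
      have "(\<lambda>i. LINT x|M. (H x (X i) - H x z) / (X i - z)) \<longlonglongrightarrow> (LINT x|M. \<delta> x)"
      proof (rule integral_dominated_convergence[where w = "\<lambda>x. 2 * w x / r"])
        show "\<delta> \<in> borel_measurable M"
          by (rule borel_measurable_LIMSEQ_metric[where f = "\<lambda>i x. (H x (X i) - H x z) / (X i - z)"])
            (use m quot X(2) Xc in blast)+
        show "integrable M (\<lambda>x. 2 * w x / r)" using w by simp
        show "AE x in M. (\<lambda>i. (H x (X i) - H x z) / (X i - z)) \<longlonglongrightarrow> \<delta> x"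
          using quot X(2) Xc by (intro AE_I2) blast
        fix i
        show "AE x in M. norm ((H x (X i) - H x z) / (X i - z)) \<le> 2 * w x / r"
        proof (rule AE_I2)
          fix x assume x: "x \<in> space M"
          have "norm (H x (X i) - H x z) \<le> 2 * w x / r * norm (X i - z)"
            by (rule holomorphic_Lipschitz_at_centre[OF hol[OF x] S r(2,1) bd[OF x] Xc(2)])
          then show "norm ((H x (X i) - H x z) / (X i - z)) \<le> 2 * w x / r"
            using Xc(3)[of i] by (simp add: norm_divide pos_divide_le_eq)
        qed
      qed (rule m)
      moreover have "(LINT x|M. (H x (X i) - H x z) / (X i - z))
          = ((LINT x|M. H x (X i)) - (LINT x|M. H x z)) / (X i - z)" for i
        using Bochner_Integration.integral_diff[OF int[OF Xc(1)] int[OF zc]] by simp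
      ultimately show "(\<lambda>i. ((LINT x|M. H x (X i)) - (LINT x|M. H x z)) / (X i - z)) \<longlonglongrightarrow> (LINT x|M. \<delta> x)"
        by (simp only:)
    qed
    moreover have "at z within cball z (r/2) = at z"
      using r by (intro at_within_interior) simp
    ultimately show ?thesis unfolding has_field_derivative_iff by metis
  qed
  then show ?thesis using holomorphic_on_open[OF S] by blast
qed

section \<open>Powers of comparable numbers\<close>

text \<open>The exponent may have either sign, so both bounds on \<open>t / m\<close> are needed; the factor \<open>C powr P\<close>
  is uniform for exponents in \<open>[- P, P]\<close>.\<close>

lemma powr_comparable:
  fixes C m t q P :: real
  assumes m: "0 < m" and C: "1 \<le> C" and t: "m / C \<le> t" "t \<le> C * m" and q: "\<bar>q\<bar> \<le> P"
  shows "t powr q \<le> C powr P * m powr q"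
proof -
  have t0: "0 < t" using m C t(1) by (smt (verit) divide_pos_pos)
  define u where "u = t / m"
  have u: "0 < u" "1 / C \<le> u" "u \<le> C" "t = u * m"
    using m C t t0 by (auto simp: u_def field_simps)
  have "u powr q \<le> C powr \<bar>q\<bar>"
  proof (cases "q \<ge> 0")
    case True
    then show ?thesis using u by (simp add: powr_mono2)
  next
    case False
    have "u powr q = (1 / u) powr (- q)" using u by (simp add: powr_minus_divide powr_divide)
    also have "\<dots> \<le> C powr (- q)"
      using u C False by (intro powr_mono2) (auto simp: field_simps)
    finally show ?thesis using False by simp
  qed
  also have "\<dots> \<le> C powr P" using C q by (intro powr_mono) auto
  finally show ?thesis using u m by (simp add: powr_mult mult_right_mono)
qed

text \<open>This is the gain of one power of \<open>a\<close>: the mean value inequality on the segment from \<open>a\<close> to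
  \<open>b\<close>, all of whose points are comparable to \<open>a\<close>.\<close>

lemma norm_powr_diff_le:
  fixes a b C P :: real and z :: complex
  assumes a: "0 < a" and C: "1 \<le> C" and b: "a / C \<le> b" "b \<le> C * a" and P: "\<bar>Re z - 1\<bar> \<le> P"
  shows "norm (of_real a powr z - of_real b powr z)
           \<le> norm z * (C powr P * a powr (Re z - 1)) * \<bar>a - b\<bar>"
proof -
  let ?S = "closed_segment (complex_of_real a) (of_real b)"
  have aC: "a / C \<le> a" "a \<le> C * a" "0 < a / C"
    using a C by (auto simp: field_simps)
  have seg: "\<exists>t. w = of_real t \<and> a / C \<le> t \<and> t \<le> C * a" if "w \<in> ?S" for w
  proof -
    obtain u where u: "0 \<le> u" "u \<le> 1" "w = (1 - u) *\<^sub>R of_real a + u *\<^sub>R of_real b"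
      using \<open>w \<in> ?S\<close> by (auto simp: in_segment)
    have "(1 - u) * a + u * b \<ge> a / C" "(1 - u) * a + u * b \<le> C * a"
      using u aC b convex_bound_le[of a "C * a" b "1 - u" u]
        convex_bound_le[of "- a" "- (a / C)" "- b" "1 - u" u] by auto
    moreover have "w = of_real ((1 - u) * a + u * b)" using u by (simp add: scaleR_conv_of_real)
    ultimately show ?thesis by blast
  qed
  have "norm (of_real a powr z - of_real b powr z)
      \<le> (norm z * (C powr P * a powr (Re z - 1))) * norm (complex_of_real a - of_real b)"
  proof (rule field_differentiable_bound[where S = ?S and f' = "\<lambda>w. z * w powr (z - 1)"])
    fix w assume "w \<in> ?S"
    then obtain t where t: "w = of_real t" "a / C \<le> t" "t \<le> C * a" using seg by blast
    then have t0: "t > 0" using aC by linarith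
    show "((\<lambda>w. w powr z) has_field_derivative z * w powr (z - 1)) (at w within ?S)"
    proof (rule has_field_derivative_at_within, rule has_field_derivative_powr)
      show "w \<notin> \<real>\<^sub>\<le>\<^sub>0" using t0 t(1) by simp
    qed
    have "norm (w powr (z - 1)) = t powr (Re z - 1)"
      using t0 t(1) by (simp add: norm_powr_real_powr)
    also have "\<dots> \<le> C powr P * a powr (Re z - 1)"
      using t a C P by (intro powr_comparable) auto
    finally show "norm (z * w powr (z - 1)) \<le> norm z * (C powr P * a powr (Re z - 1))"
      by (simp add: norm_mult mult_left_mono)
  qed auto
  then show ?thesis by (simp flip: of_real_diff)
qed

section \<open>Equivalence of norms\<close>

lemma is_norm_norm: "is_norm norm"
  by (simp add: is_norm_def norm_triangle_ineq)

text \<open>A norm is convex, and convex functions on a finite-dimensional space are continuous.\<close>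

lemma is_norm_continuous:
  fixes \<nu> :: "real ^ 'n \<Rightarrow> real"
  assumes "is_norm \<nu>"
  shows "continuous_on UNIV \<nu>"
proof (rule convex_on_continuous)
  show "convex_on UNIV \<nu>"
  proof (rule convex_onI)
    fix t x y assume "0 < (t::real)" "t < 1"
    then show "\<nu> ((1 - t) *\<^sub>R x + t *\<^sub>R y) \<le> (1 - t) * \<nu> x + t * \<nu> y"
      using assms unfolding is_norm_def by (smt (verit))
  qed auto
qed auto

text \<open>The unit sphere is compact, so a norm has a positive minimum and a finite maximum on it;
  homogeneity does the rest.\<close>

lemma is_norm_equivalent:
  fixes \<nu> :: "real ^ 'n \<Rightarrow> real"
  assumes \<nu>: "is_norm \<nu>"
  obtains C where "1 \<le> C" "\<And>x. norm x / C \<le> \<nu> x" "\<And>x. \<nu> x \<le> C * norm x"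
proof -
  let ?S = "sphere (0::real^'n) 1"
  have ne: "?S \<noteq> {}" by simp
  have cont: "continuous_on ?S \<nu>" using is_norm_continuous[OF \<nu>] continuous_on_subset by blast
  obtain p where p: "p \<in> ?S" "\<And>y. y \<in> ?S \<Longrightarrow> \<nu> p \<le> \<nu> y"
    using continuous_attains_inf[OF compact_sphere ne cont] by blast
  obtain q where q: "\<And>y. y \<in> ?S \<Longrightarrow> \<nu> y \<le> \<nu> q"
    using continuous_attains_sup[OF compact_sphere ne cont] by blast
  have "p \<noteq> 0" using p(1) by auto
  then have pos: "\<nu> p > 0" using \<nu> unfolding is_norm_def by (metis order_le_less)
  have scale: "\<nu> x = norm x * \<nu> (x /\<^sub>R norm x)" if "x \<noteq> 0" for x
  proof -
    have "\<nu> x = \<nu> (norm x *\<^sub>R (x /\<^sub>R norm x))" using that by simp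
    also have "\<dots> = norm x * \<nu> (x /\<^sub>R norm x)" using \<nu> unfolding is_norm_def by (metis abs_norm_cancel)
    finally show ?thesis .
  qed
  have zero: "\<nu> 0 = 0" using \<nu> unfolding is_norm_def by blast
  define C where "C = Max {1, \<nu> q, 1 / \<nu> p}"
  have C: "1 \<le> C" "\<nu> q \<le> C" "1 / \<nu> p \<le> C" by (auto simp: C_def)
  have C': "1 / C \<le> \<nu> p" using C(1,3) pos by (simp add: field_simps)
  have "norm x / C \<le> \<nu> x \<and> \<nu> x \<le> C * norm x" for x
  proof (cases "x = 0")
    case True then show ?thesis using zero by simp
  next
    case False
    then have "x /\<^sub>R norm x \<in> ?S" by simp
    then have "1 / C \<le> \<nu> (x /\<^sub>R norm x)" "\<nu> (x /\<^sub>R norm x) \<le> C"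
      using p(2) q C' C(2) by (blast intro: order_trans)+
    then have "norm x * (1 / C) \<le> norm x * \<nu> (x /\<^sub>R norm x)"
       "norm x * \<nu> (x /\<^sub>R norm x) \<le> norm x * C" by (intro mult_left_mono; simp)+
    then show ?thesis using scale[OF False] by (simp add: mult.commute)
  qed
  then show ?thesis using that C(1) by blast
qed

section \<open>Integrability of powers above the upper box dimension\<close>

text \<open>The infimum defining the dimension yields some \<open>r' < r\<close> with vanishing upper content, whose
  quotients are therefore eventually below 1. The strict inequality \<open>r' < r\<close> is what makes the
  geometric series below converge.\<close>

lemma tail_measure_bound:
  fixes \<Omega> :: "(real ^ 'n) set"
  assumes "upper_box_dim_infty \<Omega> < ereal r"
  obtains r' t0 where "r' < r" "1 \<le> t0"
    "\<And>t. t0 \<le> t \<Longrightarrow> emeasure lebesgue (tail t \<Omega>) \<le> ennreal (t powr (real CARD('n) + r'))"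
proof -
  obtain r' where r': "upper_minkowski_content_infty r' \<Omega> = 0" "r' < r"
    using assms unfolding upper_box_dim_infty_def Inf_less_iff by auto
  then have "Limsup at_top (\<lambda>t::real. emeasure lebesgue (tail t \<Omega>) / ennreal (t powr (real CARD('n) + r'))) < 1"
    by (simp add: upper_minkowski_content_infty_def)
  then have "\<forall>\<^sub>F t in at_top. emeasure lebesgue (tail t \<Omega>) / ennreal (t powr (real CARD('n) + r')) < 1"
    by (rule Limsup_lessD)
  then obtain t0 where t0: "\<And>t. t0 \<le> t \<Longrightarrow> emeasure lebesgue (tail t \<Omega>) / ennreal (t powr (real CARD('n) + r')) < 1"
    by (auto simp: eventually_at_top_linorder)
  show ?thesis
  proof (rule that[of r' "max 1 t0"])
    fix t assume t: "max 1 t0 \<le> t"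
    then have "emeasure lebesgue (tail t \<Omega>) / ennreal (t powr (real CARD('n) + r')) < 1" using t0 by simp
    then show "emeasure lebesgue (tail t \<Omega>) \<le> ennreal (t powr (real CARD('n) + r'))"
      using t by (subst (asm) divide_less_ennreal) auto
  qed (use r' in auto)
qed

lemma dyadic_bracket:
  fixes y :: real
  assumes "1 \<le> y"
  obtains k where "2 ^ k \<le> y" "y \<le> 2 ^ Suc k"
proof -
  obtain n where "y < 2 ^ n" using real_arch_pow[of 2 y] by auto
  define m where "m = (LEAST n. y < 2 ^ n)"
  have m: "y < 2 ^ m" unfolding m_def by (rule LeastI[of _ n]) fact
  then obtain k where k: "m = Suc k" using assms by (cases m) auto
  have "\<not> y < 2 ^ k" using not_less_Least[of k "\<lambda>n. y < 2 ^ n"] k m_def by simp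
  then show ?thesis using that[of k] m k by simp
qed

lemma tail_sets [measurable]: "\<Omega> \<in> sets lebesgue \<Longrightarrow> tail t \<Omega> \<in> sets lebesgue"
  unfolding tail_def by (intro sets.Int) (auto intro: borel_open)

text \<open>If the exponent \<open>p = - r - N\<close> is not positive, finiteness of the measure suffices. Otherwise
  decompose the tail from \<open>t0\<close> on into the shells \<open>t0 * 2 ^ k \<le> \<bar>x\<bar> \<le> t0 * 2 ^ Suc k\<close>. Up to a
  constant, the \<open>k\<close>-th shell contributes at most
  \<open>(t0 * 2 ^ k) powr p * (t0 * 2 ^ k) powr (N + r') = (t0 * 2 ^ k) powr (r' - r)\<close>,
  which is a geometric sequence with ratio \<open>2 powr (r' - r) < 1\<close>. The maximum with 1 keeps the
  weight bounded near the origin for negative exponents.\<close>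

lemma integrable_norm_powr_over_upper_box_dim:
  fixes \<Omega> :: "(real ^ 'n) set"
  assumes \<Omega>: "\<Omega> \<in> sets lebesgue" and fin: "emeasure lebesgue \<Omega> < \<infinity>"
    and r: "upper_box_dim_infty \<Omega> < ereal r"
  shows "integrable lebesgue (\<lambda>x. indicator \<Omega> x * max 1 (norm x) powr (- r - real CARD('n)))"
proof -
  define p where "p = - r - real CARD('n)"
  define f where "f x = indicator \<Omega> x * max 1 (norm x) powr p" for x :: "real^'n"
  have mf[measurable]: "f \<in> borel_measurable lebesgue"
  proof -
    have "(\<lambda>x :: real^'n. max 1 (norm x) powr p) \<in> borel_measurable lborel" by measurable
    then have [measurable]: "(\<lambda>x :: real^'n. max 1 (norm x) powr p) \<in> borel_measurable lebesgue"
      by (rule measurable_completion)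
    show ?thesis unfolding f_def using \<Omega> by measurable
  qed
  have f0: "f x \<ge> 0" for x by (simp add: f_def)
  have "(\<integral>\<^sup>+x. ennreal (f x) \<partial>lebesgue) < \<infinity>"
  proof (cases "p \<le> 0")
    case True
    have "f x \<le> indicator \<Omega> x" for x
    proof -
      have "max 1 (norm x) powr p \<le> max 1 (norm x) powr 0" using True by (intro powr_mono) auto
      also have "\<dots> = 1" by auto
      finally show ?thesis by (simp add: f_def indicator_def)
    qed
    then have "(\<integral>\<^sup>+x. ennreal (f x) \<partial>lebesgue) \<le> (\<integral>\<^sup>+x. ennreal (indicator \<Omega> x) \<partial>lebesgue)"
      by (intro nn_integral_mono ennreal_leI) auto
    also have "\<dots> = emeasure lebesgue \<Omega>" using \<Omega> by (simp add: ennreal_indicator)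
    finally show ?thesis using fin by simp
  next
    case False
    obtain r' t0 where r': "r' < r" "1 \<le> t0" and
      tail: "\<And>t. t0 \<le> t \<Longrightarrow> emeasure lebesgue (tail t \<Omega>) \<le> ennreal (t powr (real CARD('n) + r'))"
      by (rule tail_measure_bound[OF r]) blast
    \<comment> \<open>\<open>c k\<close> bounds the integrand on the \<open>k\<close>-th shell, \<open>q\<close> is the ratio of the geometric series.\<close>
    define c where "c k = (t0 * 2 ^ Suc k) powr p" for k :: nat
    define q where "q = 2 powr (r' - r)"
    have q: "0 < q" "q < 1" using r' by (auto simp: q_def powr_less_one)
    define A where "A = t0 powr (r' - r) * 2 powr p"
    have "ennreal (f x) \<le> ennreal (t0 powr p) * indicator \<Omega> x
            + (\<Sum>k. ennreal (c k) * indicator (tail (t0 * 2 ^ k) \<Omega>) x)" for x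
    proof (cases "x \<in> \<Omega> \<and> t0 \<le> norm x")
      case True
      then have "1 \<le> norm x / t0" using r' by simp
      then obtain k where k: "2 ^ k \<le> norm x / t0" "norm x / t0 \<le> 2 ^ Suc k"
        by (rule dyadic_bracket)
      then have k': "t0 * 2 ^ k \<le> norm x" "norm x \<le> t0 * 2 ^ Suc k"
        using r' by (auto simp: field_simps)
      have "f x = norm x powr p" using True r' by (simp add: f_def max_def)
      also have "\<dots> \<le> c k" unfolding c_def using k' False by (intro powr_mono2) auto
      finally have "ennreal (f x) \<le> ennreal (c k) * indicator (tail (t0 * 2 ^ k) \<Omega>) x"
        using True k' by (simp add: tail_def ennreal_leI)
      also have "\<dots> \<le> (\<Sum>k. ennreal (c k) * indicator (tail (t0 * 2 ^ k) \<Omega>) x)"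
        using sum_le_suminf[where I = "{k}" and f = "\<lambda>k. ennreal (c k) * indicator (tail (t0 * 2 ^ k) \<Omega>) x"]
        by (simp del: sum_mult_indicator)
      finally show ?thesis by (simp add: add_increasing)
    next
      case F: False
      then have "f x \<le> t0 powr p * indicator \<Omega> x"
        using r' False by (auto simp: f_def indicator_def intro!: powr_mono2)
      then have "ennreal (f x) \<le> ennreal (t0 powr p) * indicator \<Omega> x"
        using f0[of x] by (auto simp: indicator_def ennreal_leI split: if_splits)
      then show ?thesis by (simp add: add_increasing2)
    qed
    then have "(\<integral>\<^sup>+x. ennreal (f x) \<partial>lebesgue) \<le> (\<integral>\<^sup>+x. (ennreal (t0 powr p) * indicator \<Omega> x
            + (\<Sum>k. ennreal (c k) * indicator (tail (t0 * 2 ^ k) \<Omega>) x)) \<partial>lebesgue)"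
      by (intro nn_integral_mono) auto
    also have "\<dots> = ennreal (t0 powr p) * emeasure lebesgue \<Omega>
            + (\<Sum>k. ennreal (c k) * emeasure lebesgue (tail (t0 * 2 ^ k) \<Omega>))"
      using \<Omega> tail_sets[OF \<Omega>] by (subst nn_integral_add) (auto simp: nn_integral_suminf nn_integral_cmult)
    also have "\<dots> \<le> ennreal (t0 powr p) * emeasure lebesgue \<Omega> + (\<Sum>k. ennreal (A * q ^ k))"
    proof (intro add_left_mono suminf_le)
      fix k
      have t: "t0 \<le> t0 * 2 ^ k" using r' by simp
      have "ennreal (c k) * emeasure lebesgue (tail (t0 * 2 ^ k) \<Omega>)
         \<le> ennreal (c k) * ennreal ((t0 * 2 ^ k) powr (real CARD('n) + r'))"
        by (intro mult_left_mono tail[OF t]) auto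
      also have "\<dots> = ennreal (c k * (t0 * 2 ^ k) powr (real CARD('n) + r'))"
        by (simp add: ennreal_mult c_def)
      also have "c k * (t0 * 2 ^ k) powr (real CARD('n) + r')
          = 2 powr p * (t0 * 2 ^ k) powr (p + (real CARD('n) + r'))"
        using r' by (simp add: c_def powr_add powr_mult mult_ac)
      also have "p + (real CARD('n) + r') = r' - r" by (simp add: p_def)
      also have "2 powr p * (t0 * 2 ^ k) powr (r' - r) = A * q ^ k"
        using r' by (simp add: A_def q_def powr_mult powr_power mult_ac flip: powr_realpow powr_powr)
          (simp add: powr_powr mult.commute)
      finally show "ennreal (c k) * emeasure lebesgue (tail (t0 * 2 ^ k) \<Omega>) \<le> ennreal (A * q ^ k)" .
    qed auto
    also have "(\<Sum>k. ennreal (A * q ^ k)) = ennreal (\<Sum>k. A * q ^ k)"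
      using q by (intro suminf_ennreal2) (auto simp: A_def intro!: summable_mult summable_geometric)
    also have "ennreal (t0 powr p) * emeasure lebesgue \<Omega> + ennreal (\<Sum>k. A * q ^ k) < \<infinity>"
      using fin by (simp add: ennreal_mult_less_top)
    finally show ?thesis .
  qed
  then have "integrable lebesgue f" using f0 by (intro integrableI_nonneg) auto
  then show ?thesis unfolding f_def p_def .
qed

section \<open>The integrands of the zeta functions\<close>

text \<open>The cut-off is part of the integrand, so that the two zeta functions become integrals over the
  same space and can be subtracted under the integral sign.\<close>

definition zeta_integrand ::
    "real \<Rightarrow> (real ^ 'n) set \<Rightarrow> (real ^ 'n \<Rightarrow> real) \<Rightarrow> complex \<Rightarrow> real ^ 'n \<Rightarrow> complex" where
  "zeta_integrand T \<Omega> \<nu> z x = indicator {x \<in> \<Omega>. T \<le> \<nu> x} x *\<^sub>R complex_of_real (\<nu> x) powr z"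

lemma zeta_infty_norm_eq:
  fixes \<Omega> :: "(real ^ 'n) set"
  shows "zeta_infty_norm T \<Omega> \<nu> s = (LINT x|lebesgue. zeta_integrand T \<Omega> \<nu> (- s - of_nat CARD('n)) x)"
  by (simp add: zeta_infty_norm_def set_lebesgue_integral_def zeta_integrand_def)

lemma zeta_infty_eq: "zeta_infty T \<Omega> s = zeta_infty_norm T \<Omega> norm s"
proof -
  have "tail T \<Omega> = {x \<in> \<Omega>. T \<le> norm x}" by (auto simp: tail_def)
  then show ?thesis by (simp add: zeta_infty_def zeta_infty_norm_def)
qed

lemma zeta_integrand_measurable:
  fixes \<Omega> :: "(real ^ 'n) set"
  assumes \<nu>: "is_norm \<nu>" and \<Omega>: "\<Omega> \<in> sets lebesgue" and T: "T > 0"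
  shows "zeta_integrand T \<Omega> \<nu> z \<in> borel_measurable lebesgue"
proof -
  have [measurable]: "\<nu> \<in> borel_measurable lebesgue"
    using borel_measurable_continuous_onI[OF is_norm_continuous[OF \<nu>]]
    by (simp add: measurable_completion)
  have "{x \<in> \<Omega>. T \<le> \<nu> x} = \<Omega> \<inter> {x \<in> space lebesgue. T \<le> \<nu> x}" by auto
  also have "\<dots> \<in> sets lebesgue" by (intro sets.Int \<Omega>) measurable
  finally have [measurable]: "{x \<in> \<Omega>. T \<le> \<nu> x} \<in> sets lebesgue" .
  have "zeta_integrand T \<Omega> \<nu> z =
      (\<lambda>x. indicator {x \<in> \<Omega>. T \<le> \<nu> x} x *\<^sub>R exp (z * complex_of_real (ln (\<nu> x))))"
    using T by (auto simp: zeta_integrand_def indicator_def powr_def Ln_of_real fun_eq_iff)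
  also have "\<dots> \<in> borel_measurable lebesgue" by measurable
  finally show ?thesis .
qed

lemma zeta_integrand_holomorphic:
  assumes "T > 0"
  shows "(\<lambda>s. zeta_integrand T \<Omega> \<nu> (- s - c) x) holomorphic_on S"
proof (cases "x \<in> \<Omega> \<and> T \<le> \<nu> x")
  case True
  then have "\<nu> x \<noteq> 0" using assms by auto
  then show ?thesis using True by (auto simp: zeta_integrand_def powr_def intro!: holomorphic_intros)
next
  case False
  then have "(\<lambda>s. zeta_integrand T \<Omega> \<nu> (- s - c) x) = (\<lambda>s. 0)"
    by (auto simp: zeta_integrand_def indicator_def)
  then show ?thesis by simp
qed

text \<open>Where the integrand is nonzero, the argument of the power lies in \<open>[1 / Q, Q]\<close>. This is used on
  bounded parts of \<open>\<Omega>\<close>.\<close>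

lemma zeta_integrand_bounded:
  assumes "1 \<le> Q" "1 / T \<le> Q" "T > 0" "T \<le> \<nu> x \<Longrightarrow> \<nu> x \<le> Q" "norm z \<le> P"
  shows "norm (zeta_integrand T \<Omega> \<nu> z x) \<le> Q powr P"
proof (cases "x \<in> \<Omega> \<and> T \<le> \<nu> x")
  case True
  then have "\<nu> x > 0" using assms by simp
  have "1 / Q \<le> T" using assms by (simp add: field_simps)
  then have "\<nu> x powr Re z \<le> Q powr P * 1 powr Re z"
    using assms True abs_Re_le_cmod[of z] by (intro powr_comparable) auto
  then show ?thesis using True \<open>\<nu> x > 0\<close> by (simp add: zeta_integrand_def norm_powr_real_powr)
next
  case False
  then show ?thesis by (auto simp: zeta_integrand_def)
qed

text \<open>On the set where \<open>\<nu> x \<ge> T\<close>, the numbers \<open>\<nu> x\<close> and \<open>max 1 (norm x)\<close> are comparable: for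
  \<open>norm x \<ge> 1\<close> by equivalence of norms, and otherwise because \<open>\<nu> x\<close> lies between \<open>T\<close> and a constant.\<close>

lemma zeta_integrand_integrable:
  fixes \<Omega> :: "(real ^ 'n) set"
  assumes \<nu>: "is_norm \<nu>" and \<Omega>: "\<Omega> \<in> sets lebesgue" and T: "T > 0"
    and int: "integrable lebesgue (\<lambda>x. indicator \<Omega> x * max 1 (norm x) powr Re z)"
  shows "integrable lebesgue (zeta_integrand T \<Omega> \<nu> z)"
proof -
  obtain C where C: "1 \<le> C" "\<And>x. norm x / C \<le> \<nu> x" "\<And>x. \<nu> x \<le> C * norm x"
    by (rule is_norm_equivalent[OF \<nu>]) blast
  define Q where "Q = max C (1 / T)"
  have Q: "1 \<le> Q" "C \<le> Q" "1 / T \<le> Q" using C(1) by (auto simp: Q_def)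
  have Q': "1 / Q \<le> T" using Q(1,3) T by (simp add: field_simps)
  have bound: "norm (zeta_integrand T \<Omega> \<nu> z x)
      \<le> Q powr \<bar>Re z\<bar> * (indicator \<Omega> x * max 1 (norm x) powr Re z)" for x
  proof (cases "x \<in> \<Omega> \<and> T \<le> \<nu> x")
    case True
    then have pos: "\<nu> x > 0" using T by simp
    have "\<nu> x powr Re z \<le> Q powr \<bar>Re z\<bar> * max 1 (norm x) powr Re z"
    proof (rule powr_comparable)
      show "max 1 (norm x) / Q \<le> \<nu> x"
      proof (cases "norm x \<ge> 1")
        case True
        then have "norm x / Q \<le> norm x / C" using Q C(1) by (intro divide_left_mono) auto
        then show ?thesis using C(2)[of x] True by simp
      next
        case False
        then show ?thesis using Q' True by simp
      qed
      have "\<nu> x \<le> C * norm x" by (rule C)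
      also have "\<dots> \<le> Q * max 1 (norm x)" using Q by (intro mult_mono) auto
      finally show "\<nu> x \<le> Q * max 1 (norm x)" .
    qed (use Q in auto)
    then show ?thesis using True pos by (simp add: zeta_integrand_def norm_powr_real_powr)
  next
    case False
    then show ?thesis by (auto simp: zeta_integrand_def)
  qed
  show ?thesis
  proof (rule Bochner_Integration.integrable_bound)
    show "integrable lebesgue (\<lambda>x. Q powr \<bar>Re z\<bar> * (indicator \<Omega> x * max 1 (norm x) powr Re z))"
      using int by (rule integrable_mult_right)
    show "zeta_integrand T \<Omega> \<nu> z \<in> borel_measurable lebesgue"
      by (rule zeta_integrand_measurable[OF \<nu> \<Omega> T])
    show "AE x in lebesgue. norm (zeta_integrand T \<Omega> \<nu> z x)
      \<le> norm (Q powr \<bar>Re z\<bar> * (indicator \<Omega> x * max 1 (norm x) powr Re z))"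
      using bound by (intro AE_I2) (smt (verit) real_norm_def)
  qed
qed

text \<open>The exponent of the weight is \<open>q - (1 - \<alpha>)\<close> although each of the two powers only has size
  \<open>norm x powr q\<close>: for large \<open>x\<close> one power is gained by the mean value inequality and \<open>\<alpha>\<close> is given
  back by the order of equivalence of the norms. The constant \<open>B\<close> takes care of bounded \<open>x\<close>, where
  the cut-offs of the two terms may differ and no cancellation is available.\<close>

lemma zeta_integrand_diff_bound:
  fixes \<Omega> :: "(real ^ 'n) set"
  assumes \<nu>: "is_norm \<nu>" and T: "T > 0" and P: "0 \<le> P"
    and eq: "norms_equiv_order \<alpha> \<Omega> norm \<nu>"
  obtains A B where "0 \<le> A" "0 \<le> B"
    "\<And>x z. norm z \<le> P \<Longrightarrow> Re z \<le> q \<Longrightarrow>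
       norm (zeta_integrand T \<Omega> norm z x - zeta_integrand T \<Omega> \<nu> z x)
         \<le> A * (indicator \<Omega> x * max 1 (norm x) powr (q - (1 - \<alpha>))) + B * indicator \<Omega> x"
proof -
  obtain C where C: "1 \<le> C" "\<And>x. norm x / C \<le> \<nu> x" "\<And>x. \<nu> x \<le> C * norm x"
    by (rule is_norm_equivalent[OF \<nu>]) blast
  obtain K where K: "K > 0" and ev: "\<forall>\<^sub>F x in inf (filtercomap norm at_top) (principal \<Omega>).
      norm (norm x - \<nu> x) \<le> K * norm (norm x powr \<alpha>)"
    using eq unfolding norms_equiv_order_def by (elim landau_o.bigE) auto
  obtain M0 where M0: "\<And>x. x \<in> \<Omega> \<Longrightarrow> M0 \<le> norm x \<Longrightarrow> \<bar>norm x - \<nu> x\<bar> \<le> K * norm x powr \<alpha>"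
    using ev unfolding eventually_inf_principal eventually_filtercomap_at_top_linorder by auto
  \<comment> \<open>From \<open>M\<close> on, the asymptotic estimate holds and both cut-offs are inactive; \<open>C * T\<close> takes
    care of the cut-off for \<open>\<nu>\<close>.\<close>
  define M where "M = Max {M0, 1, C * T, T}"
  have M: "M0 \<le> M" "1 \<le> M" "C * T \<le> M" "T \<le> M" by (auto simp: M_def)
  define Q where "Q = max (C * M) (1 / T)"
  have CM: "M \<le> C * M" using C M by simp
  have Q: "1 \<le> Q" "1 / T \<le> Q" "C * M \<le> Q" "M \<le> Q" using M(2) CM unfolding Q_def by linarith+
  define A where "A = P * C powr (P + 1) * K"
  define B where "B = 2 * Q powr P"
  have A0: "0 \<le> A" and B0: "0 \<le> B" using P K by (auto simp: A_def B_def)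
  show ?thesis
  proof (rule that[OF A0 B0])
    fix x :: "real^'n" and z :: complex
    assume z: "norm z \<le> P" "Re z \<le> q"
    let ?d = "zeta_integrand T \<Omega> norm z x - zeta_integrand T \<Omega> \<nu> z x"
    consider "x \<notin> \<Omega>" | "x \<in> \<Omega>" "norm x < M" | "x \<in> \<Omega>" "M \<le> norm x" by linarith
    then show "norm ?d \<le> A * (indicator \<Omega> x * max 1 (norm x) powr (q - (1 - \<alpha>))) + B * indicator \<Omega> x"
    proof cases
      case 1
      then show ?thesis by (simp add: zeta_integrand_def)
    next
      case 2
      have "\<nu> x \<le> C * norm x" by (rule C)
      also have "\<dots> \<le> C * M" using C 2 by simp
      finally have \<nu>Q: "\<nu> x \<le> Q" using Q by linarith
      have "norm ?d \<le> norm (zeta_integrand T \<Omega> norm z x) + norm (zeta_integrand T \<Omega> \<nu> z x)"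
        by (rule norm_triangle_ineq4)
      also have "\<dots> \<le> Q powr P + Q powr P"
        using 2 Q T z \<nu>Q by (intro add_mono zeta_integrand_bounded) auto
      finally show ?thesis using 2 A0 by (simp add: B_def add_increasing)
    next
      case 3
      let ?a = "norm x"
      have a: "1 \<le> ?a" "T \<le> ?a" "0 < ?a" using 3 M by linarith+
      have "T \<le> ?a / C" using C(1) M 3 by (simp add: field_simps)
      then have T\<nu>: "T \<le> \<nu> x" using C(2)[of x] by linarith
      have "norm ?d = norm (of_real ?a powr z - of_real (\<nu> x) powr z)"
        using 3 a T\<nu> by (simp add: zeta_integrand_def)
      also have "\<dots> \<le> norm z * (C powr (P + 1) * ?a powr (Re z - 1)) * \<bar>?a - \<nu> x\<bar>"
        using a C z abs_Re_le_cmod[of z] by (intro norm_powr_diff_le) auto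
      also have "\<dots> \<le> P * (C powr (P + 1) * ?a powr (q - 1)) * (K * ?a powr \<alpha>)"
        using a z P M0[OF 3(1)] 3 M C(1) by (intro mult_mono powr_mono) auto
      also have "\<dots> = A * ?a powr (q - (1 - \<alpha>))"
      proof -
        have "?a powr (q - 1) * ?a powr \<alpha> = ?a powr (q - (1 - \<alpha>))"
          by (simp flip: powr_add add: algebra_simps)
        then show ?thesis by (simp add: A_def)
      qed
      finally show ?thesis using 3 a B0 by (simp add: max_def)
    qed
  qed
qed

section \<open>Holomorphic continuation of the difference\<close>

lemma open_right_half_plane: "open (right_half_plane a)"
  unfolding right_half_plane_def by (intro open_Collect_less continuous_intros)

theorem theorem4p4:
  fixes \<Omega> :: "(real ^ 'n) set" and \<nu> :: "real ^ 'n \<Rightarrow> real" and \<alpha> T :: real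
  assumes "\<Omega> \<subseteq> UNIV - {0}"
    and "\<Omega> \<in> sets lebesgue"
    and "emeasure lebesgue \<Omega> < \<infinity>"
    and "upper_box_dim_infty \<Omega> < ereal (- real CARD('n))"
    and "is_norm \<nu>"
    and "\<alpha> < 1"
    and "norms_equiv_order \<alpha> \<Omega> norm \<nu>"
    and "T > 0"
  shows "extends_holomorphically (\<lambda>s. zeta_infty T \<Omega> s - zeta_infty_norm T \<Omega> \<nu> s)
           (upper_box_dim_infty \<Omega>) (upper_box_dim_infty \<Omega> - ereal (1 - \<alpha>))"
proof -
  define D where "D = upper_box_dim_infty \<Omega>"
  define S where "S = right_half_plane (D - ereal (1 - \<alpha>))"
  define N where "N = real CARD('n)"
  define H where "H x s = zeta_integrand T \<Omega> norm (- s - of_nat CARD('n)) x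
                        - zeta_integrand T \<Omega> \<nu> (- s - of_nat CARD('n)) x" for x s
  note meas = zeta_integrand_measurable[OF _ assms(2,8)]
  have hol: "(\<lambda>s. LINT x|lebesgue. H x s) holomorphic_on S"
  proof (rule holomorphic_on_dominated_integral)
    show "open S" unfolding S_def by (rule open_right_half_plane)
    show "(\<lambda>x. H x s) \<in> borel_measurable lebesgue" for s
      unfolding H_def using meas[OF is_norm_norm] meas[OF assms(5)] by (intro borel_measurable_diff)
    show "H x holomorphic_on S" for x
      unfolding H_def by (intro holomorphic_on_diff zeta_integrand_holomorphic assms)
    fix z assume "z \<in> S"
    then have "D - ereal (1 - \<alpha>) < ereal (Re z)" by (simp add: S_def right_half_plane_def)
    then have "D < ereal (Re z + (1 - \<alpha>))"
      by (cases D) auto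
    then obtain r0 where r0: "D < ereal r0" "r0 < Re z + (1 - \<alpha>)"
      using ereal_dense2 by fastforce
    \<comment> \<open>The dominating weight has exponent \<open>- r0 - N\<close>, which covers all \<open>s\<close> with
      \<open>Re s \<ge> \<tau>\<close>. Since \<open>\<tau> < Re z\<close>, a disc about \<open>z\<close> fits into that half-plane.\<close>
    define \<tau> where "\<tau> = r0 - (1 - \<alpha>)"
    define \<rho> where "\<rho> = (Re z - \<tau>) / 2"
    define P where "P = norm z + \<rho> + N"
    have \<rho>: "\<rho> > 0" using r0 by (simp add: \<rho>_def \<tau>_def)
    have P: "P \<ge> 0" using \<rho> by (simp add: P_def N_def)
    obtain A B where AB: "0 \<le> A" "0 \<le> B"
      "\<And>x w. norm w \<le> P \<Longrightarrow> Re w \<le> - \<tau> - N \<Longrightarrow>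
         norm (zeta_integrand T \<Omega> norm w x - zeta_integrand T \<Omega> \<nu> w x)
         \<le> A * (indicator \<Omega> x * max 1 (norm x) powr (- \<tau> - N - (1 - \<alpha>))) + B * indicator \<Omega> x"
      using zeta_integrand_diff_bound[OF assms(5,8) P assms(7), where q = "- \<tau> - N"] by blast
    define w where "w x = A * (indicator \<Omega> x * max 1 (norm x) powr (- r0 - N)) + B * indicator \<Omega> x" for x
    have near: "\<tau> \<le> Re s \<and> norm (- s - of_nat CARD('n)) \<le> P" if "s \<in> cball z \<rho>" for s
    proof
      have d: "norm (z - s) \<le> \<rho>" using that by (simp add: dist_norm)
      have "Re z - Re s \<le> \<rho>" using d abs_Re_le_cmod[of "z - s"] by simp
      then show "\<tau> \<le> Re s" using \<rho> unfolding \<rho>_def by argo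
      have "norm (- s - of_nat CARD('n)) \<le> norm (- s) + norm (of_nat CARD('n) :: complex)"
        by (rule norm_triangle_ineq4)
      also have "norm (- s) \<le> norm z + norm (z - s)"
        using norm_triangle_sub[of s z] by (simp add: norm_minus_commute)
      finally show "norm (- s - of_nat CARD('n)) \<le> P" using d by (simp add: P_def N_def)
    qed
    have "cball z \<rho> \<subseteq> S"
    proof
      fix s assume "s \<in> cball z \<rho>"
      then have "ereal \<tau> \<le> ereal (Re s)" using near by simp
      moreover have "D - ereal (1 - \<alpha>) < ereal \<tau>" using r0(1) by (cases D) (auto simp: \<tau>_def)
      ultimately have "D - ereal (1 - \<alpha>) < ereal (Re s)" by (rule order_less_le_trans[rotated])
      then show "s \<in> S" by (simp add: S_def right_half_plane_def)
    qed
    moreover have "integrable lebesgue w"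
    proof -
      have "integrable lebesgue (\<lambda>x. indicator \<Omega> x * max 1 (norm x) powr (- r0 - N))"
        unfolding N_def using r0(1) unfolding D_def
        by (rule integrable_norm_powr_over_upper_box_dim[OF assms(2,3)])
      moreover have "integrable lebesgue (indicator \<Omega> :: real ^ 'n \<Rightarrow> real)"
        using assms(2,3) by (rule integrable_real_indicator)
      ultimately show ?thesis unfolding w_def
        by (intro Bochner_Integration.integrable_add integrable_mult_right)
    qed
    moreover have "\<forall>x\<in>space lebesgue. \<forall>s\<in>cball z \<rho>. norm (H x s) \<le> w x"
    proof (intro ballI)
      fix x s assume "s \<in> cball z \<rho>"
      note s = near[OF this]
      have "Re (- s - of_nat CARD('n)) \<le> - \<tau> - N" using s by (simp add: N_def)
      moreover have e: "- \<tau> - N - (1 - \<alpha>) = - r0 - N" by (simp add: \<tau>_def)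
      ultimately show "norm (H x s) \<le> w x"
        using AB(3)[of "- s - of_nat CARD('n)" x, unfolded e] s by (simp add: H_def w_def)
    qed
    ultimately show "\<exists>r>0. \<exists>w. cball z r \<subseteq> S \<and> integrable lebesgue w \<and>
          (\<forall>x\<in>space lebesgue. \<forall>s\<in>cball z r. norm (H x s) \<le> w x)"
      using \<rho> by blast
  qed
  have eq: "(LINT x|lebesgue. H x s) = zeta_infty T \<Omega> s - zeta_infty_norm T \<Omega> \<nu> s"
    if "s \<in> right_half_plane D" for s
  proof -
    have int: "integrable lebesgue (zeta_integrand T \<Omega> \<mu> (- s - of_nat CARD('n)))" if "is_norm \<mu>" for \<mu>
      using integrable_norm_powr_over_upper_box_dim[OF assms(2,3), of "Re s"] \<open>s \<in> right_half_plane D\<close>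
      by (intro zeta_integrand_integrable that assms) (auto simp: D_def right_half_plane_def)
    then show ?thesis
      unfolding zeta_infty_eq zeta_infty_norm_eq H_def
      by (intro Bochner_Integration.integral_diff int is_norm_norm assms(5))
  qed
  show ?thesis
    unfolding extends_holomorphically_def using hol eq unfolding D_def S_def by blast
qed

end
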